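(* Let $X$ be a finite graph, let $p\in X$, and let $n=\mathrm{ord}(p,X)$. Then for each $A\in C(p,X)$ and each $\varepsilon>0$ there exists a closed subset $\mathcal{A}\subset C(p,X)$ such that $\mathcal{A}$ contains an $n$-cell and $H_2(\mathcal{A},\{A\})<\varepsilon$.
   Context: A continuum is a nonempty compact connected metric space. A finite graph is a continuum that can be written as the union of finitely many arcs, any two of which are either disjoint or intersect only in one or both of their end points. A simple $n$-od ($n\ge 1$) is a finite graph which is the union of $n$ arcs emanating from a single point $v$ (the vertex) and otherwise disjoint from each other. For a finite graph $X$ and $p\in X$, $\mathrm{ord}(p,X)=n$ means that $p$ has a closed neighborhood in $X$ homeomorphic to a simple $n$-od having $p$ as its vertex (where for $n=1$ this means that $p$ is an end point of an arc neighborhood, and for $n=2$ that $p$ is an interior point of an arc neighborhood). Points of order $1$, $2$, $\ge 3$ are called end points, ordinary points and ramification points; the vertices of $X$ are the points of order different from $2$, and an edge is any arc joining two vertices (which may coincide, so that the edge is a loop) and containing no other vertices. The finite graph $X$ carries the arc length metric $d$: $d(x,y)$ is the length of a shortest path in $X$ joining $x$ and $y$, where each edge has length $1$ (if $X$ is a simple closed curve, which has no vertices, take an arc length metric on it). $2^X$ is the set of nonempty closed subsets of $X$ with the Hausdorff metric $H(A,B)=\inf\{\varepsilon>0: A\subset N(\varepsilon,B)\text{ and }B\subset N(\varepsilon,A)\}$, where $N(\varepsilon,A)$ is the set of points at distance less than $\varepsilon$ from some point of $A$. $C(X)\subset 2^X$ is the subspace of nonempty closed connected subsets of $X$, and $C(p,X)=\{A\in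 C(X): p\in A\}$. $H_2$ is the Hausdorff metric on the nonempty closed subsets of $(2^X,H)$ induced by $H$. An $n$-cell is any space homeomorphic to $[0,1]^n$. *)

theory Defs
  imports "HOL-Analysis.Analysis"
begin

section \<open>Finite graphs\<close>

text \<open>Spaces are subsets of a metric type. Arcs are given by their parametrisations, the end
  points being \<^const>\<open>pathstart\<close> and \<^const>\<open>pathfinish\<close>; two parametrisations of the same arc
  never occur together in the family \<open>G\<close>, because they violate the intersection condition.\<close>

definition continuum :: "'a::metric_space set \<Rightarrow> bool"
  where "continuum X \<longleftrightarrow> X \<noteq> {} \<and> compact X \<and> connected X"

definition finite_graph :: "'a::metric_space set \<Rightarrow> bool"
  where "finite_graph X \<longleftrightarrow> continuum X \<and>
    (\<exists>G. finite G \<and> (\<forall>g\<in>G. arc g) \<and> X = (\<Union>g\<in>G. path_image g) \<and>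
      (\<forall>g\<in>G. \<forall>h\<in>G. g \<noteq> h \<longrightarrow>
        path_image g \<inter> path_image h \<subseteq> {pathstart g, pathfinish g} \<inter> {pathstart h, pathfinish h}))"

definition simple_od :: "nat \<Rightarrow> 'a::metric_space \<Rightarrow> 'a set \<Rightarrow> bool"
  where "simple_od n v T \<longleftrightarrow> n \<ge> 1 \<and> finite_graph T \<and>
    (\<exists>g :: nat \<Rightarrow> real \<Rightarrow> 'a.
      (\<forall>i<n. arc (g i) \<and> pathstart (g i) = v) \<and>
      T = (\<Union>i<n. path_image (g i)) \<and>
      (\<forall>i<n. \<forall>j<n. i \<noteq> j \<longrightarrow> path_image (g i) \<inter> path_image (g j) = {v}))"

text \<open>Being a simple \<open>n\<close>-od with a given vertex is invariant under homeomorphism, so the closed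
  neighbourhood \<open>N\<close> of \<open>p\<close> is itself required to be one. For \<open>n = 1\<close> and \<open>n = 2\<close> it is an arc
  with \<open>p\<close> as an end point, respectively an interior point.\<close>

definition has_order :: "'a::metric_space \<Rightarrow> 'a set \<Rightarrow> nat \<Rightarrow> bool"
  where "has_order p X n \<longleftrightarrow>
    (\<exists>N. closedin (top_of_set X) N \<and>
      (\<exists>U. openin (top_of_set X) U \<and> p \<in> U \<and> U \<subseteq> N) \<and> simple_od n p N)"

definition graph_vertices :: "'a::metric_space set \<Rightarrow> 'a set"
  where "graph_vertices X = {v \<in> X. \<not> has_order v X 2}"

text \<open>\<^const>\<open>simple_path\<close> allows the two ends to coincide, so loops are included.\<close>

definition graph_edge :: "'a::metric_space set \<Rightarrow> (real \<Rightarrow> 'a) \<Rightarrow> bool"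
  where "graph_edge X g \<longleftrightarrow> simple_path g \<and> path_image g \<subseteq> X \<and>
    path_image g \<inter> graph_vertices X = {pathstart g, pathfinish g}"


section \<open>Arc length metric\<close>

definition path_length :: "(real \<Rightarrow> 'a::metric_space) \<Rightarrow> ennreal"
  where "path_length g =
    (SUP (m, t) \<in> {(m :: nat, t :: nat \<Rightarrow> real). mono t \<and> range t \<subseteq> {0..1}}.
      \<Sum>i<m. ennreal (dist (g (t i)) (g (t (Suc i)))))"

definition paths_between :: "'a::metric_space set \<Rightarrow> 'a \<Rightarrow> 'a \<Rightarrow> (real \<Rightarrow> 'a) set"
  where "paths_between X x y =
    {g. path g \<and> path_image g \<subseteq> X \<and> pathstart g = x \<and> pathfinish g = y}"

text \<open>The ambient \<^const>\<open>dist\<close> on \<open>X\<close> is the arc length metric: lengths are measured with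
  \<^const>\<open>dist\<close> itself, every edge has length 1, and the distance of two points is the length of a
  shortest path in \<open>X\<close>. If \<open>X\<close> is a simple closed curve there are no edges, and its total
  length is arbitrary.\<close>

definition arc_length_metric :: "'a::metric_space set \<Rightarrow> bool"
  where "arc_length_metric X \<longleftrightarrow>
    (\<forall>g. graph_edge X g \<longrightarrow> path_length g = 1) \<and>
    (\<forall>x\<in>X. \<forall>y\<in>X. \<exists>g\<in>paths_between X x y.
      ennreal (dist x y) = path_length g \<and> (\<forall>h\<in>paths_between X x y. path_length g \<le> path_length h))"


section \<open>Hyperspaces\<close>

definition nbhd :: "('a \<Rightarrow> 'a \<Rightarrow> real) \<Rightarrow> real \<Rightarrow> 'a set \<Rightarrow> 'a set"
  where "nbhd d e A = {x. \<exists>a\<in>A. d x a < e}"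

definition hausdorff_radii :: "('a \<Rightarrow> 'a \<Rightarrow> real) \<Rightarrow> 'a set \<Rightarrow> 'a set \<Rightarrow> real set"
  where "hausdorff_radii d A B = {e. e > 0 \<and> A \<subseteq> nbhd d e B \<and> B \<subseteq> nbhd d e A}"

text \<open>The first case never occurs for nonempty bounded sets. It is there because
  \<^term>\<open>Inf {} :: real\<close> is unspecified, whereas the locale \<^locale>\<open>Metric_space\<close> wants distances
  to be nonnegative also outside the carrier.\<close>

definition hausdorff_dist :: "('a \<Rightarrow> 'a \<Rightarrow> real) \<Rightarrow> 'a set \<Rightarrow> 'a set \<Rightarrow> real"
  where "hausdorff_dist d A B =
    (if hausdorff_radii d A B = {} then 0 else Inf (hausdorff_radii d A B))"

definition hyper_closed :: "'a::metric_space set \<Rightarrow> 'a set set"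
  where "hyper_closed X = {A. A \<noteq> {} \<and> closedin (top_of_set X) A}"

definition hyper_conn :: "'a::metric_space set \<Rightarrow> 'a set set"
  where "hyper_conn X = {A \<in> hyper_closed X. connected A}"

definition hyper_conn_at :: "'a::metric_space \<Rightarrow> 'a set \<Rightarrow> 'a set set"
  where "hyper_conn_at p X = {A \<in> hyper_conn X. p \<in> A}"

abbreviation hyper_dist :: "'a::metric_space set \<Rightarrow> 'a set \<Rightarrow> real"
  where "hyper_dist \<equiv> hausdorff_dist dist"

abbreviation hyper_dist2 :: "'a::metric_space set set \<Rightarrow> 'a set set \<Rightarrow> real"
  where "hyper_dist2 \<equiv> hausdorff_dist hyper_dist"

definition hyper_topology :: "'a::metric_space set \<Rightarrow> 'a set topology"
  where "hyper_topology X = Metric_space.mtopology (hyper_closed X) hyper_dist"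

definition n_cell :: "nat \<Rightarrow> 'b topology \<Rightarrow> bool"
  where "n_cell n T \<longleftrightarrow>
    T homeomorphic_space product_topology (\<lambda>_. top_of_set {0..1::real}) {..<n}"


text \<open>\<^const>\<open>hyper_topology\<close> is only meaningful because of the instance of \<^locale>\<open>Metric_space\<close>
  established here.\<close>

lemma hausdorff_dist_nonneg: "0 \<le> hausdorff_dist d A B"
  unfolding hausdorff_dist_def
  by (auto simp: hausdorff_radii_def intro!: cInf_greatest)

lemma hausdorff_dist_commute: "hausdorff_dist d A B = hausdorff_dist d B A"
proof -
  have "hausdorff_radii d A B = hausdorff_radii d B A"
    by (auto simp: hausdorff_radii_def)
  then show ?thesis by (simp add: hausdorff_dist_def)
qed

lemma hausdorff_radii_nonempty:
  fixes X :: "'a::metric_space set"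
  assumes "bounded X" "A \<subseteq> X" "B \<subseteq> X" "A \<noteq> {}" "B \<noteq> {}"
  shows "hausdorff_radii dist A B \<noteq> {}"
proof -
  obtain e where e: "\<And>x y. x \<in> X \<Longrightarrow> y \<in> X \<Longrightarrow> dist x y \<le> e"
    using \<open>bounded X\<close> by (metis bounded_two_points)
  have lt: "dist x y < max e 0 + 1" if "x \<in> X" "y \<in> X" for x y
    using e[OF that] by linarith
  have "S \<subseteq> nbhd dist (max e 0 + 1) T" if "S \<subseteq> X" "T \<subseteq> X" "T \<noteq> {}" for S T
    using that lt unfolding nbhd_def by blast
  then have "max e 0 + 1 \<in> hausdorff_radii dist A B"
    using assms by (simp add: hausdorff_radii_def)
  then show ?thesis by blast
qed

lemma hausdorff_dist_less_iff:
  assumes "hausdorff_radii d A B \<noteq> {}"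
  shows "hausdorff_dist d A B < r \<longleftrightarrow> (\<exists>e\<in>hausdorff_radii d A B. e < r)"
proof -
  have "bdd_below (hausdorff_radii d A B)"
    by (rule bdd_belowI[of _ 0]) (simp add: hausdorff_radii_def)
  then show ?thesis
    using assms by (simp add: hausdorff_dist_def cInf_less_iff)
qed

lemma Metric_space_hyper_closed:
  fixes X :: "'a::metric_space set"
  assumes "compact X"
  shows "Metric_space (hyper_closed X) hyper_dist"
proof
  have bdd: "bounded X" using assms by (rule compact_imp_bounded)
  have sub: "A \<subseteq> X" "A \<noteq> {}" "closed A" if "A \<in> hyper_closed X" for A
    using that closedin_subset closedin_closed_trans[OF _ compact_imp_closed[OF assms]]
    by (fastforce simp: hyper_closed_def)+
  have ne: "hausdorff_radii dist A B \<noteq> {}" if "A \<in> hyper_closed X" "B \<in> hyper_closed X" for A B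
    using that sub by (intro hausdorff_radii_nonempty[OF bdd])
  show "0 \<le> hyper_dist A B" for A B :: "'a set" by (rule hausdorff_dist_nonneg)
  show "hyper_dist A B = hyper_dist B A" for A B :: "'a set" by (rule hausdorff_dist_commute)
  have incl: "A \<subseteq> B"
    if A: "A \<in> hyper_closed X" and B: "B \<in> hyper_closed X" and 0: "hyper_dist A B = 0" for A B
  proof
    fix x assume "x \<in> A"
    have "\<exists>y\<in>B. dist y x < r" if "r > 0" for r
    proof -
      obtain e where "e \<in> hausdorff_radii dist A B" "e < r"
        using hausdorff_dist_less_iff[OF ne[OF A B], of r] 0 \<open>r > 0\<close> by metis
      then obtain y where "y \<in> B" "dist x y < e"
        using \<open>x \<in> A\<close> by (auto simp: hausdorff_radii_def nbhd_def)
      then show ?thesis using \<open>e < r\<close> by (force simp: dist_commute)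
    qed
    then show "x \<in> B" using sub(3)[OF B] by (metis closed_approachable)
  qed
  show "hyper_dist A B = 0 \<longleftrightarrow> A = B" if A: "A \<in> hyper_closed X" and B: "B \<in> hyper_closed X" for A B
  proof
    assume "hyper_dist A B = 0"
    then show "A = B" using incl[OF A B] incl[OF B A] hausdorff_dist_commute[of dist A B] by auto
  next
    assume "A = B"
    have "hyper_dist A A < r" if "r > 0" for r
    proof -
      have "r/2 \<in> hausdorff_radii dist A A"
        using that by (force simp: hausdorff_radii_def nbhd_def)
      then show ?thesis
        using that hausdorff_dist_less_iff[OF ne[OF A A], of r] by force
    qed
    then have "\<not> 0 < hyper_dist A A" by blast
    then show "hyper_dist A B = 0"
      using \<open>A = B\<close> hausdorff_dist_nonneg[of dist A A] by simp
  qed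
  show "hyper_dist A C \<le> hyper_dist A B + hyper_dist B C"
    if A: "A \<in> hyper_closed X" and B: "B \<in> hyper_closed X" and C: "C \<in> hyper_closed X" for A B C
  proof (rule field_le_epsilon)
    fix r :: real assume "r > 0"
    obtain e where e: "e \<in> hausdorff_radii dist A B" "e < hyper_dist A B + r/2"
      using hausdorff_dist_less_iff[OF ne[OF A B], of "hyper_dist A B + r/2"] \<open>r > 0\<close>
      by (metis half_gt_zero less_add_same_cancel1)
    obtain f where f: "f \<in> hausdorff_radii dist B C" "f < hyper_dist B C + r/2"
      using hausdorff_dist_less_iff[OF ne[OF B C], of "hyper_dist B C + r/2"] \<open>r > 0\<close>
      by (metis half_gt_zero less_add_same_cancel1)
    have tri: "S \<subseteq> nbhd dist (u + v) U" if ST: "S \<subseteq> nbhd dist u T" and TU: "T \<subseteq> nbhd dist v U"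
      for S T U :: "'a set" and u v
    proof
      fix x assume "x \<in> S"
      then obtain y where "y \<in> T" "dist x y < u" using ST by (auto simp: nbhd_def)
      moreover then obtain z where "z \<in> U" "dist y z < v" using TU by (auto simp: nbhd_def)
      ultimately show "x \<in> nbhd dist (u + v) U"
        using dist_triangle[of x z y] by (force simp: nbhd_def)
    qed
    have "e + f \<in> hausdorff_radii dist A C"
      using e(1) f(1) tri[of A e B f C] tri[of C f B e A]
      by (simp add: hausdorff_radii_def add.commute)
    moreover have "e + f < hyper_dist A B + hyper_dist B C + r" using e f by simp
    ultimately have "hyper_dist A C < hyper_dist A B + hyper_dist B C + r"
      using hausdorff_dist_less_iff[OF ne[OF A C]] by blast
    then show "hyper_dist A C \<le> hyper_dist A B + hyper_dist B C + r" by simp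
  qed
qed

end

theory Submission
  imports Defs
begin

text \<open>Call a compact connected set \<open>B\<close> containing \<open>p\<close>, together with \<open>n\<close> arcs (the whiskers) that
  start in \<open>B\<close>, meet \<open>B\<close> nowhere else and meet each other at most in \<open>B\<close>, a whiskered
  continuum. Cutting every whisker at a freely chosen parameter gives an \<open>n\<close>-parameter family
  of continua containing \<open>p\<close>. It depends continuously and injectively on the parameters, so by
  compactness of the cube it is an \<open>n\<close>-cell, closed in the hyperspace
  (\<open>whiskered_n_cell\<close>). All members lie between \<open>B\<close> and the union of \<open>B\<close> with the full
  whiskers. Hence it suffices to find a whiskered continuum that stays in a small neighbourhood of
  \<open>A\<close> and whose \<open>B\<close> already comes close to every point of \<open>A\<close>; the cell itself then serves
  as the required closed family.

  Such a continuum is grown from \<open>B = {p}\<close>, with short initial pieces of the \<open>n\<close> arms at \<open>p\<close>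
  as whiskers; this is the only place where the order of \<open>p\<close> enters. The points \<open>f\<close> of a
  finite net of \<open>A\<close> are then approached one at a time (\<open>whiskered_reach\<close>). Take an arc \<open>g\<close> from
  \<open>p\<close> to \<open>f\<close> close to \<open>A\<close>, and look at the part after its last visit to \<open>B\<close> and the
  whiskers. If it leaves from \<open>B\<close>, it is added to \<open>B\<close>. If it leaves from a whisker, that
  whisker is cut there and continued along \<open>g\<close> to \<open>f\<close>, and then all of it except a small end
  piece is absorbed into \<open>B\<close>. The number of whiskers is unchanged, \<open>B\<close> only grows, and so
  nothing gained earlier is lost. If \<open>f\<close> already lies on a whisker, that whisker is cut at \<open>f\<close> and
  absorbed in the same way. Cycles in \<open>A\<close> do no harm: every new piece is attached at a single
  point, so no cycle is ever closed, and coming close to the net is enough.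

  The arcs \<open>g\<close> exist because balls of an arc length metric are path connected
  (\<open>path_component_nbhd\<close>), and every path contains an arc (\<open>arc_in_path_image\<close>).\<close>

section \<open>Arcs in metric spaces\<close>

text \<open>The theorem \<open>path_contains_arc\<close> is about complete normed spaces. It transfers to an arbitrary
  metric space along the Kuratowski embedding, which is an isometry into the Banach space of
  bounded continuous functions.\<close>

lemma arc_in_path_image:
  fixes g :: "real \<Rightarrow> 'a::metric_space"
  assumes g: "path g" and ne: "pathstart g \<noteq> pathfinish g"
  obtains h where "arc h" "path_image h \<subseteq> path_image g"
    "pathstart h = pathstart g" "pathfinish h = pathfinish g"
proof -
  fix a :: 'a
  \<comment> \<open>Subtracting the distance to a base point makes the distance functions bounded.\<close>
  define \<phi> :: "'a \<Rightarrow> 'a \<Rightarrow>\<^sub>C real" where "\<phi> x = Bcontfun (\<lambda>y. dist x y - dist a y)" for x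
  have app: "apply_bcontfun (\<phi> x) y = dist x y - dist a y" for x y
  proof -
    have "(\<lambda>y. dist x y - dist a y) \<in> bcontfun"
    proof (rule bcontfun_normI)
      show "norm (dist x y - dist a y) \<le> dist x a" for y
        using abs_dist_diff_le[of x y a] by (simp add: dist_commute)
    qed (intro continuous_intros)
    then show ?thesis by (simp add: \<phi>_def Bcontfun_inverse)
  qed
  have iso: "dist (\<phi> x) (\<phi> y) = dist x y" for x y
  proof (rule antisym)
    show "dist (\<phi> x) (\<phi> y) \<le> dist x y"
    proof (rule dist_bound)
      show "dist (apply_bcontfun (\<phi> x) z) (apply_bcontfun (\<phi> y) z) \<le> dist x y" for z
        using abs_dist_diff_le[of x z y] by (simp add: app dist_real_def dist_commute)
    qed
    have "dist (apply_bcontfun (\<phi> x) y) (apply_bcontfun (\<phi> y) y) \<le> dist (\<phi> x) (\<phi> y)"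
      by (rule dist_bounded)
    then show "dist x y \<le> dist (\<phi> x) (\<phi> y)" by (simp add: app dist_real_def)
  qed
  have inj: "inj \<phi>" by (metis injI iso dist_eq_0_iff)
  have cont: "continuous_on S \<phi>" for S
    unfolding continuous_on_iff using iso by auto
  have "path (\<phi> \<circ> g)"
    using g cont unfolding path_def by (blast intro: continuous_on_compose)
  moreover have "\<phi> (pathstart g) \<noteq> \<phi> (pathfinish g)" using ne inj by (simp add: inj_eq)
  ultimately have "path (\<phi> \<circ> g)" "pathstart (\<phi> \<circ> g) \<noteq> pathfinish (\<phi> \<circ> g)"
    by (simp_all add: pathstart_compose pathfinish_compose)
  then obtain q where q: "arc q" "path_image q \<subseteq> path_image (\<phi> \<circ> g)"
    "pathstart q = \<phi> (pathstart g)" "pathfinish q = \<phi> (pathfinish g)"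
    using path_contains_arc[OF _ refl refl, of "\<phi> \<circ> g"]
    by (auto simp: pathstart_compose pathfinish_compose)
  define \<psi> where "\<psi> = inv \<phi>"
  have \<psi>: "\<psi> (\<phi> x) = x" for x by (simp add: \<psi>_def inj)
  have ran: "path_image q \<subseteq> range \<phi>" using q(2) by (auto simp: path_image_compose)
  have iso': "dist (\<psi> u) (\<psi> v) = dist u v" if "u \<in> range \<phi>" "v \<in> range \<phi>" for u v
    using that \<psi> iso by auto
  have "continuous_on (range \<phi>) \<psi>"
    unfolding continuous_on_iff
  proof (intro ballI allI impI)
    fix u and e :: real assume "u \<in> range \<phi>" "e > 0"
    then show "\<exists>d>0. \<forall>v\<in>range \<phi>. dist v u < d \<longrightarrow> dist (\<psi> v) (\<psi> u) < e"
      using iso' by (intro exI[of _ e]) simp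
  qed
  moreover have "inj_on \<psi> (range \<phi>)" using \<psi> by (auto intro: inj_onI)
  ultimately have "arc (\<psi> \<circ> q)"
    using q(1) ran unfolding arc_def path_def path_image_def
    by (meson comp_inj_on continuous_on_compose continuous_on_subset inj_on_subset)
  moreover have "path_image (\<psi> \<circ> q) \<subseteq> path_image g"
    using q(2) \<psi> by (auto simp: path_image_compose)
  moreover have "pathstart (\<psi> \<circ> q) = pathstart g" "pathfinish (\<psi> \<circ> q) = pathfinish g"
    using q(3,4) \<psi> by (simp_all add: pathstart_compose pathfinish_compose)
  ultimately show ?thesis using that by blast
qed

text \<open>This takes the place of \<open>subpath\<close>, whose type is tied to normed spaces.\<close>

lemma arc_reparametrize:
  fixes g :: "real \<Rightarrow> 'a::metric_space"
  assumes "arc g" "0 \<le> u" "u < v" "v \<le> 1"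
  obtains h where "arc h" "path_image h = g ` {u..v}" "pathstart h = g u" "pathfinish h = g v"
proof
  let ?l = "\<lambda>t. u + (v - u) * t"
  have im: "?l ` {0..1} = {u..v}"
    using image_affinity_atLeastAtMost[of "v-u" u 0 1] assms(3) by (simp add: algebra_simps)
  show "path_image (g \<circ> ?l) = g ` {u..v}"
    by (simp only: path_image_def image_comp[symmetric] im)
  have sub: "{u..v} \<subseteq> {0..1}" using assms by auto
  have "continuous_on {0..1} ?l" by (intro continuous_intros)
  moreover have "inj_on ?l {0..1}" using assms by (auto simp: inj_on_def)
  ultimately show "arc (g \<circ> ?l)"
    using assms(1) sub im unfolding arc_def path_def
    by (metis comp_inj_on continuous_on_compose continuous_on_subset inj_on_subset)
qed (simp_all add: pathstart_def pathfinish_def)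

section \<open>Path connectedness near a connected set\<close>

text \<open>The two-point subdivision is one of those whose supremum is the length.\<close>

lemma dist_le_path_length:
  assumes "t \<in> {0..1}"
  shows "ennreal (dist (pathstart g) (g t)) \<le> path_length g"
proof -
  let ?t = "\<lambda>i::nat. if i = 0 then 0 else t"
  have "ennreal (dist (g 0) (g t)) = (\<Sum>i<1. ennreal (dist (g (?t i)) (g (?t (Suc i)))))"
    by simp
  also have "\<dots> \<le> path_length g"
    unfolding path_length_def
    by (rule SUP_upper2[of "(1, ?t)"]) (use assms in \<open>auto simp: mono_def\<close>)
  finally show ?thesis by (simp add: pathstart_def)
qed

text \<open>A shortest path cannot leave the ball, since reaching any of its
  points already costs the distance to it.\<close>

lemma geodesic_in_cball:
  assumes "arc_length_metric X" "x \<in> X" "y \<in> X"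
  obtains g where "g \<in> paths_between X x y" "path_image g \<subseteq> cball x (dist x y)"
proof -
  obtain g where g: "g \<in> paths_between X x y" "ennreal (dist x y) = path_length g"
    using assms unfolding arc_length_metric_def by blast
  have "dist x (g t) \<le> dist x y" if "t \<in> {0..1}" for t
  proof -
    have "ennreal (dist x (g t)) \<le> ennreal (dist x y)"
      unfolding g(2) using dist_le_path_length[OF that, of g] g(1) by (simp add: paths_between_def)
    then show ?thesis by simp
  qed
  then have "path_image g \<subseteq> cball x (dist x y)" by (auto simp: path_image_def)
  then show ?thesis using that g(1) by blast
qed

text \<open>Nearby points of \<open>A\<close> are joined by a geodesic that stays close to \<open>A\<close>, and a connected set admits
  only one class of points that can be joined by chains of such short steps.\<close>

lemma path_component_nbhd:
  assumes X: "arc_length_metric X" and A: "connected A" "A \<subseteq> X" and r: "r > 0"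
    and xy: "x \<in> A" "y \<in> A"
  shows "path_component (X \<inter> nbhd dist r A) x y"
proof (rule connected_equivalence_relation[OF A(1)])
  fix a assume a: "a \<in> A"
  have "path_component (X \<inter> nbhd dist r A) a b" if b: "b \<in> A \<inter> ball a r" for b
  proof -
    obtain g where g: "g \<in> paths_between X a b" "path_image g \<subseteq> cball a (dist a b)"
      using geodesic_in_cball[OF X, of a b] a b A by blast
    have "path_image g \<subseteq> nbhd dist r A"
      using g(2) a b unfolding nbhd_def by (force simp: dist_commute)
    then show ?thesis
      using g(1) unfolding path_component_def paths_between_def by blast
  qed
  then show "\<exists>T. openin (top_of_set A) T \<and> a \<in> T \<and> (\<forall>b\<in>T. path_component (X \<inter> nbhd dist r A) a b)"
    using a r by (intro exI[of _ "A \<inter> ball a r"]) auto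
qed (use xy in \<open>auto intro: path_component_sym path_component_trans\<close>)

section \<open>Bounds for Hausdorff distances\<close>

lemma hausdorff_dist_le_radius:
  assumes "e > 0" "A \<subseteq> nbhd d e B" "B \<subseteq> nbhd d e A"
  shows "hausdorff_dist d A B \<le> e"
proof -
  have e: "e \<in> hausdorff_radii d A B" using assms by (simp add: hausdorff_radii_def)
  have "bdd_below (hausdorff_radii d A B)"
    by (rule bdd_belowI[of _ 0]) (simp add: hausdorff_radii_def)
  then show ?thesis using e by (auto simp: hausdorff_dist_def intro: cInf_lower)
qed

lemma hausdorff_dist_singleton_le:
  assumes ne: "\<A> \<noteq> {}" and e: "e > 0" and le: "\<And>K. K \<in> \<A> \<Longrightarrow> d K A < e" "\<And>K. K \<in> \<A> \<Longrightarrow> d A K < e"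
  shows "hausdorff_dist d \<A> {A} \<le> e"
proof (rule hausdorff_dist_le_radius[OF e])
  show "\<A> \<subseteq> nbhd d e {A}" using le(1) by (auto simp: nbhd_def)
  show "{A} \<subseteq> nbhd d e \<A>" using ne le(2) by (auto simp: nbhd_def)
qed

section \<open>Whiskered continua and their cells\<close>

text \<open>Whiskers may share their starting point, as they all do when \<open>B\<close> is \<open>{p}\<close>.\<close>

definition whiskered :: "'a::metric_space \<Rightarrow> nat \<Rightarrow> 'a set \<Rightarrow> (nat \<Rightarrow> real \<Rightarrow> 'a) \<Rightarrow> bool"
  where "whiskered p n B w \<longleftrightarrow> p \<in> B \<and> compact B \<and> connected B \<and>
    (\<forall>i<n. arc (w i) \<and> path_image (w i) \<inter> B = {pathstart (w i)}) \<and>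
    (\<forall>i<n. \<forall>j<n. i \<noteq> j \<longrightarrow> path_image (w i) \<inter> path_image (w j) \<subseteq> B)"

definition whisker_union :: "nat \<Rightarrow> 'a::metric_space set \<Rightarrow> (nat \<Rightarrow> real \<Rightarrow> 'a) \<Rightarrow> 'a set"
  where "whisker_union n B w = B \<union> (\<Union>i<n. path_image (w i))"

definition trimmed :: "nat \<Rightarrow> 'a::metric_space set \<Rightarrow> (nat \<Rightarrow> real \<Rightarrow> 'a) \<Rightarrow> (nat \<Rightarrow> real) \<Rightarrow> 'a set"
  where "trimmed n B w t = B \<union> (\<Union>i<n. w i ` {0..t i})"

lemma whiskeredD:
  assumes "whiskered p n B w"
  shows "p \<in> B" "compact B" "connected B"
    "\<And>i. i < n \<Longrightarrow> arc (w i)"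
    "\<And>i. i < n \<Longrightarrow> path_image (w i) \<inter> B = {w i 0}"
    "\<And>i j. \<lbrakk>i < n; j < n; i \<noteq> j\<rbrakk> \<Longrightarrow> path_image (w i) \<inter> path_image (w j) \<subseteq> B"
  using assms unfolding whiskered_def pathstart_def by auto

lemma trimmed_props:
  assumes W: "whiskered p n B w" and t: "\<forall>i<n. t i \<in> {0..1}"
  shows "compact (trimmed n B w t)" "connected (trimmed n B w t)" "p \<in> trimmed n B w t"
    "B \<subseteq> trimmed n B w t" "trimmed n B w t \<subseteq> whisker_union n B w"
proof -
  note D = whiskeredD[OF W]
  have cont: "continuous_on {0..t i} (w i)" if "i < n" for i
    using D(4)[OF that] t that unfolding arc_def path_def
    by (elim conjE continuous_on_subset) auto
  show "compact (trimmed n B w t)"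
    unfolding trimmed_def using cont D(2)
    by (intro compact_Un compact_UN) (auto intro: compact_continuous_image)
  have "connected (B \<union> w i ` {0..t i})" if "i < n" for i
  proof (rule connected_Un)
    show "connected (w i ` {0..t i})" using cont[OF that] by (blast intro: connected_continuous_image connected_Icc)
    have "w i 0 \<in> w i ` {0..t i}" using t that by auto
    then show "B \<inter> w i ` {0..t i} \<noteq> {}" using D(5)[OF that] by blast
  qed (use D in auto)
  then have "connected (\<Union>(insert B ((\<lambda>i. B \<union> w i ` {0..t i}) ` {..<n})))"
    using D(1,3) by (intro connected_Union) auto
  moreover have "\<Union>(insert B ((\<lambda>i. B \<union> w i ` {0..t i}) ` {..<n})) = trimmed n B w t"
    unfolding trimmed_def by auto
  ultimately show "connected (trimmed n B w t)" by simp
  show "p \<in> trimmed n B w t" "B \<subseteq> trimmed n B w t" using D(1) by (auto simp: trimmed_def)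
  show "trimmed n B w t \<subseteq> whisker_union n B w"
    using t unfolding trimmed_def whisker_union_def path_image_def by fastforce
qed

text \<open>The parameters can be read off from the set: the point at parameter \<open>s i\<close> of whisker \<open>i\<close> is
  neither in \<open>B\<close> nor on another whisker, so it can only be present if \<open>t i\<close> reaches it.\<close>

lemma trimmed_subset_imp_le:
  assumes W: "whiskered p n B w" and s: "\<forall>i<n. s i \<in> {0..1}" and t: "\<forall>i<n. t i \<in> {0..1}"
    and sub: "trimmed n B w s \<subseteq> trimmed n B w t" and i: "i < n"
  shows "s i \<le> t i"
proof (rule ccontr)
  assume "\<not> s i \<le> t i"
  then have less: "t i < s i" by simp
  note D = whiskeredD[OF W]
  have inj: "inj_on (w i) {0..1}" using D(4)[OF i] by (simp add: arc_def)
  have si: "s i \<in> {0..1}" "t i \<in> {0..1}" using s t i by auto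
  then have im: "w i (s i) \<in> path_image (w i)" by (simp add: path_image_def)
  have "w i (s i) \<noteq> w i 0" using inj_onD[OF inj, of "s i" 0] si less by auto
  then have nB: "w i (s i) \<notin> B" using D(5)[OF i] im by blast
  have "w i (s i) \<in> trimmed n B w s"
  proof -
    have "w i (s i) \<in> w i ` {0..s i}" using si by auto
    then show ?thesis using i unfolding trimmed_def by blast
  qed
  then obtain j where j: "j < n" "w i (s i) \<in> w j ` {0..t j}"
    using sub nB unfolding trimmed_def by blast
  show False
  proof (cases "j = i")
    case True
    then obtain u where "u \<in> {0..t i}" "w i (s i) = w i u" using j by auto
    then show False using inj_onD[OF inj, of "s i" u] si less by auto
  next
    case False
    have "w i (s i) \<in> path_image (w j)" using j t by (force simp: path_image_def)
    then show False using D(6)[OF i j(1)] False im nB by auto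
  qed
qed

text \<open>A point on the piece of a whisker that is cut off moves by at most the modulus of continuity when
  it is sent to the new end of that whisker. As the bound is symmetric in the parameters, this gives
  continuity in the Hausdorff metric.\<close>

lemma trimmed_subset_nbhd:
  assumes y: "\<forall>i<n. y i \<in> {0..1}" and d: "\<forall>i<n. \<bar>x i - y i\<bar> < d" "d > 0" "e > 0"
    and x: "\<forall>i<n. x i \<in> {0..1}"
    and uc: "\<And>i u v. \<lbrakk>i < n; u \<in> {0..1}; v \<in> {0..1}; \<bar>u - v\<bar> < d\<rbrakk> \<Longrightarrow> dist (w i u) (w i v) < e"
  shows "trimmed n B w y \<subseteq> nbhd dist e (trimmed n B w x)"
proof
  fix z assume z: "z \<in> trimmed n B w y"
  show "z \<in> nbhd dist e (trimmed n B w x)"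
  proof (cases "z \<in> B")
    case True
    then show ?thesis using d by (force simp: nbhd_def trimmed_def)
  next
    case False
    then obtain i u where i: "i < n" "u \<in> {0..y i}" "z = w i u" using z by (auto simp: trimmed_def)
    let ?u = "min u (x i)"
    have yi: "0 \<le> y i" "y i \<le> 1" "0 \<le> x i" "x i \<le> 1" "\<bar>x i - y i\<bar> < d" using x y d i by auto
    have "?u \<in> {0..x i}" using i yi by auto
    then have "w i ?u \<in> trimmed n B w x" using i(1) unfolding trimmed_def by blast
    moreover have "dist (w i u) (w i ?u) < e"
      by (rule uc[OF i(1)]) (use i(2) yi d in auto)
    ultimately show ?thesis using i(3) by (auto simp: nbhd_def)
  qed
qed

text \<open>A continuous injection of the compact cube into the Hausdorff hyperspace is an embedding, and its
  compact image is closed.\<close>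

lemma whiskered_n_cell:
  fixes X :: "'a::metric_space set"
  assumes W: "whiskered p n B w" and X: "compact X" and sub: "whisker_union n B w \<subseteq> X"
    and I_def: "I = PiE {..<n} (\<lambda>_. {0..1})"
  shows "n_cell n (subtopology (hyper_topology X) (trimmed n B w ` I))"
    and "closedin (hyper_topology X) (trimmed n B w ` I)"
    and "trimmed n B w ` I \<subseteq> hyper_conn_at p X"
proof -
  interpret M: Metric_space "hyper_closed X" hyper_dist by (rule Metric_space_hyper_closed[OF X])
  note D = whiskeredD[OF W]
  let ?P = "product_topology (\<lambda>_. top_of_set {0..1::real}) {..<n}"
  let ?f = "trimmed n B w"
  have top: "topspace ?P = I" by (simp add: I_def)
  have I: "\<forall>i<n. t i \<in> {0..1}" if "t \<in> I" for t using that by (auto simp: I_def PiE_iff)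
  show mem: "?f ` I \<subseteq> hyper_conn_at p X"
  proof clarify
    fix t assume "t \<in> I"
    note T = trimmed_props[OF W I[OF this]]
    have "?f t \<subseteq> X" using T(5) sub by blast
    then have "closedin (top_of_set X) (?f t)"
      using T(1) by (simp add: closed_subset compact_imp_closed)
    then show "?f t \<in> hyper_conn_at p X"
      using T by (auto simp: hyper_conn_at_def hyper_conn_def hyper_closed_def)
  qed
  then have cl: "?f t \<in> hyper_closed X" if "t \<in> I" for t
    using that by (auto simp: hyper_conn_at_def hyper_conn_def)
  have "continuous_map ?P M.mtopology ?f"
    unfolding M.continuous_map_to_metric
  proof (intro ballI allI impI)
    fix x and e :: real assume x: "x \<in> topspace ?P" and e: "e > 0"
    have "\<exists>d>0. \<forall>u\<in>{0..1}. \<forall>v\<in>{0..1}. \<bar>u - v\<bar> < d \<longrightarrow> dist (w i u) (w i v) < e/2" if "i < n" for i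
    proof -
      have "uniformly_continuous_on {0..1} (w i)"
        using D(4)[OF that] unfolding arc_def path_def by (auto intro: compact_uniformly_continuous)
      then show ?thesis using e unfolding uniformly_continuous_on_def
        by (metis dist_real_def half_gt_zero dist_commute)
    qed
    then obtain d where d: "\<And>i. i < n \<Longrightarrow> d i > 0"
      "\<And>i u v. \<lbrakk>i < n; u \<in> {0..1}; v \<in> {0..1}; \<bar>u - v\<bar> < d i\<rbrakk> \<Longrightarrow> dist (w i u) (w i v) < e/2"
      by metis
    define \<delta> where "\<delta> = Min (insert 1 (d ` {..<n}))"
    \<comment> \<open>The 1 keeps the minimum defined when there are no whiskers.\<close>
    have \<delta>: "\<delta> > 0" "\<And>i. i < n \<Longrightarrow> \<delta> \<le> d i" using d(1) by (auto simp: \<delta>_def)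
    define U where "U = PiE {..<n} (\<lambda>i. {0..1} \<inter> ball (x i) \<delta>)"
    have "openin ?P U"
      unfolding U_def openin_PiE[OF finite_lessThan] by (auto intro: openin_open_Int)
    moreover have "x \<in> U" using x \<delta>(1) unfolding top I_def U_def by (auto simp: PiE_iff)
    moreover have "?f y \<in> M.mball (?f x) e" if y: "y \<in> U" for y
    proof -
      have xI: "x \<in> I" and yI: "y \<in> I" using x y unfolding top by (auto simp: U_def I_def PiE_iff)
      have xy: "\<bar>x i - y i\<bar> < \<delta>" if "i < n" for i
        using y that by (auto simp: U_def PiE_iff dist_real_def)
      have uc: "dist (w i u) (w i v) < e/2"
        if "i < n" "u \<in> {0..1}" "v \<in> {0..1}" "\<bar>u - v\<bar> < \<delta>" for i u v
        using d(2)[of i u v] \<delta>(2)[of i] that by auto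
      have "?f x \<subseteq> nbhd dist (e/2) (?f y)"
        by (rule trimmed_subset_nbhd[OF I[OF xI] _ \<delta>(1) _ I[OF yI] uc])
          (use xy e in \<open>auto simp: abs_minus_commute\<close>)
      moreover have "?f y \<subseteq> nbhd dist (e/2) (?f x)"
        by (rule trimmed_subset_nbhd[OF I[OF yI] _ \<delta>(1) _ I[OF xI] uc]) (use xy e in auto)
      ultimately have "hyper_dist (?f x) (?f y) \<le> e/2"
        using e by (intro hausdorff_dist_le_radius) auto
      then show ?thesis using cl[OF xI] cl[OF yI] e by simp
    qed
    ultimately show "\<exists>U. openin ?P U \<and> x \<in> U \<and> (\<forall>y\<in>U. ?f y \<in> M.mball (?f x) e)" by blast
  qed
  then have cont: "continuous_map ?P (hyper_topology X) ?f" by (simp add: hyper_topology_def)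
  have haus: "Hausdorff_space (hyper_topology X)"
    by (simp add: hyper_topology_def M.Hausdorff_space_mtopology)
  have comp: "compact_space ?P"
    by (simp add: compact_space_product_topology compact_space_subtopology)
  have inj: "inj_on ?f (topspace ?P)"
  proof (rule inj_onI)
    fix s t assume st: "s \<in> topspace ?P" "t \<in> topspace ?P" "?f s = ?f t"
    then have stI: "s \<in> I" "t \<in> I" unfolding top by simp_all
    have "s i = t i" if "i < n" for i
      using trimmed_subset_imp_le[OF W I[OF stI(1)] I[OF stI(2)] _ that]
        trimmed_subset_imp_le[OF W I[OF stI(2)] I[OF stI(1)] _ that] st(3) by simp
    then show "s = t"
      by (intro PiE_ext[OF stI(1)[unfolded I_def] stI(2)[unfolded I_def]]) simp
  qed
  have "embedding_map ?P (hyper_topology X) ?f"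
    by (rule continuous_imp_embedding_map[OF cont comp haus inj])
  then have "homeomorphic_map ?P (subtopology (hyper_topology X) (?f ` I)) ?f"
    unfolding embedding_map_def top .
  then show "n_cell n (subtopology (hyper_topology X) (?f ` I))"
    unfolding n_cell_def using homeomorphic_map_imp_homeomorphic_space homeomorphic_space_sym by blast
  have "compactin (hyper_topology X) (?f ` topspace ?P)"
    using comp cont image_compactin unfolding compact_space_def by blast
  then show "closedin (hyper_topology X) (?f ` I)"
    using haus compactin_imp_closedin unfolding top by blast
qed

section \<open>Growing a whiskered continuum\<close>

lemma whiskered_replace:
  assumes W: "whiskered p n B w" and v: "arc v" "path_image v \<inter> B = {pathstart v}"
    "\<And>j. \<lbrakk>j < n; j \<noteq> i\<rbrakk> \<Longrightarrow> path_image v \<inter> path_image (w j) \<subseteq> B"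
  shows "whiskered p n B (w(i := v))"
  using W v unfolding whiskered_def by (auto simp: Int_commute)

text \<open>Cutting a whisker shortly before its end and moving the part before the cut into \<open>B\<close> brings \<open>B\<close> as
  close to the tip as desired, while a short whisker remains.\<close>

lemma whiskered_absorb:
  assumes W: "whiskered p n B w" and i: "i < n" and e: "e > 0"
  obtains B' w' where "whiskered p n B' w'" "B \<subseteq> B'"
    "whisker_union n B' w' \<subseteq> whisker_union n B w" "\<exists>b\<in>B'. dist (pathfinish (w i)) b < e"
proof -
  note D = whiskeredD[OF W]
  have cont: "continuous_on {0..1} (w i)" and inj: "inj_on (w i) {0..1}"
    using D(4)[OF i] by (auto simp: arc_def path_def)
  obtain d where d: "d > 0" "\<And>t. \<lbrakk>t \<in> {0..1}; dist t 1 < d\<rbrakk> \<Longrightarrow> dist (w i t) (w i 1) < e"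
    using cont e unfolding continuous_on_iff by (metis atLeastAtMost_iff order_refl zero_le_one)
  \<comment> \<open>The cut is strictly between the ends, so that the new whisker misses the old one's root.\<close>
  define u where "u = max (1/2) (1 - d/2)"
  have u: "0 < u" "u < 1" "dist u 1 < d" using d(1) by (auto simp: u_def dist_real_def)
  define C where "C = w i ` {0..u}"
  obtain v where v: "arc v" "path_image v = w i ` {u..1}" "pathstart v = w i u"
    using arc_reparametrize[OF D(4)[OF i], of u 1] u by (metis less_imp_le order_refl)
  have Csub: "C \<subseteq> path_image (w i)" and vsub: "path_image v \<subseteq> path_image (w i)"
    using u v(2) by (auto simp: C_def path_image_def)
  have start: "w i 0 \<in> C \<inter> B"
  proof -
    have "w i 0 \<in> C" using u by (auto simp: C_def)
    then show ?thesis using D(5)[OF i] by blast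
  qed
  have contC: "continuous_on {0..u} (w i)" using cont by (rule continuous_on_subset) (use u in auto)
  have "path_image v \<inter> B = {}"
  proof -
    have "w i 0 \<notin> path_image v"
      unfolding v(2) using inj_onD[OF inj, of 0] u by force
    moreover have "path_image v \<inter> B \<subseteq> {w i 0}" unfolding D(5)[OF i, symmetric] using vsub by auto
    ultimately show ?thesis by auto
  qed
  moreover have "path_image v \<inter> C = {w i u}"
  proof -
    have "path_image v \<inter> C = w i ` ({u..1} \<inter> {0..u})"
      unfolding v(2) C_def by (rule inj_on_image_Int[OF inj, symmetric]) (use u in auto)
    also have "{u..1} \<inter> {0..u} = {u}" using u by auto
    finally show ?thesis by simp
  qed
  ultimately have vB: "path_image v \<inter> (B \<union> C) = {pathstart v}"
    by (simp add: Int_Un_distrib v(3))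
  have wj: "path_image (w j) \<inter> (B \<union> C) = {pathstart (w j)}" if "j < n" "j \<noteq> i" for j
    using D(5)[OF that(1)] D(6)[OF that(1) i that(2)] Csub by (auto simp: pathstart_def)
  have "whiskered p n (B \<union> C) (w(i := v))"
    unfolding whiskered_def
  proof (intro conjI allI impI)
    show "p \<in> B \<union> C" using D(1) by simp
    show "compact (B \<union> C)"
      using D(2) contC unfolding C_def by (intro compact_Un compact_continuous_image) auto
    show "connected (B \<union> C)"
      using D(3) contC start unfolding C_def
      by (intro connected_Un connected_continuous_image) auto
    show "arc ((w(i := v)) j)" if "j < n" for j using D(4)[OF that] v(1) by auto
    show "path_image ((w(i := v)) j) \<inter> (B \<union> C) = {pathstart ((w(i := v)) j)}" if "j < n" for j
      using vB wj that by auto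
    show "path_image ((w(i := v)) j) \<inter> path_image ((w(i := v)) k) \<subseteq> B \<union> C"
      if "j < n" "k < n" "j \<noteq> k" for j k
      using D(6)[OF that] D(6)[OF i that(1)] D(6)[OF i that(2)] vsub that(3) by (auto split: if_splits)
  qed
  moreover have "whisker_union n (B \<union> C) (w(i := v)) \<subseteq> whisker_union n B w"
    using vsub Csub i unfolding whisker_union_def by (auto split: if_splits)
  moreover have "w i u \<in> B \<union> C" using u by (auto simp: C_def)
  moreover have "dist (pathfinish (w i)) (w i u) < e"
    using d(2)[of u] u by (simp add: pathfinish_def dist_commute)
  ultimately show ?thesis using that[of "B \<union> C" "w(i := v)"] by blast
qed

text \<open>The growth step. If the end of \<open>g\<close> is the tip of a whisker, \<open>whiskered_absorb\<close> applies, so it suffices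
  to make it one, unless the last part of \<open>g\<close> starts in \<open>B\<close> and can simply be added to \<open>B\<close>.\<close>

lemma whiskered_reach:
  assumes W: "whiskered p n B w" and g: "arc g" "pathstart g \<in> B" and e: "e > 0"
  obtains B' w' where "whiskered p n B' w'" "B \<subseteq> B'"
    "whisker_union n B' w' \<subseteq> whisker_union n B w \<union> path_image g"
    "\<exists>b\<in>B'. dist (pathfinish g) b < e"
proof -
  note D = whiskeredD[OF W]
  define T where "T = whisker_union n B w"
  note reached = that
  have replace_absorb: thesis
    if i: "i < n" and v: "arc v" "path_image v \<inter> B = {pathstart v}"
      "\<And>j. \<lbrakk>j < n; j \<noteq> i\<rbrakk> \<Longrightarrow> path_image v \<inter> path_image (w j) \<subseteq> B"
      and im: "path_image v \<subseteq> T \<union> path_image g" and fin: "pathfinish v = pathfinish g" for i v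
  proof -
    have W': "whiskered p n B (w(i := v))" by (rule whiskered_replace[OF W v])
    obtain B' w' where B': "whiskered p n B' w'" "B \<subseteq> B'"
      "whisker_union n B' w' \<subseteq> whisker_union n B (w(i := v))" "\<exists>b\<in>B'. dist (pathfinish g) b < e"
      using whiskered_absorb[OF W' i e] fin by auto
    have "whisker_union n B (w(i := v)) \<subseteq> T \<union> path_image g"
      using im unfolding whisker_union_def T_def by (auto split: if_splits)
    then have "whisker_union n B' w' \<subseteq> whisker_union n B w \<union> path_image g"
      using B'(3) unfolding T_def by blast
    then show thesis using reached B'(1,2,4) by simp
  qed
  have initial: "\<exists>v. arc v \<and> path_image v = w i ` {0..u} \<and> pathstart v = w i 0 \<and> pathfinish v = w i u \<and>
      path_image v \<subseteq> path_image (w i) \<and> path_image v \<inter> B = {w i 0} \<and>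
      (\<forall>j<n. j \<noteq> i \<longrightarrow> path_image v \<inter> path_image (w j) \<subseteq> B)"
    if i: "i < n" and u: "u \<in> {0..1}" "w i u \<notin> B" for i u
  proof -
    have "u \<noteq> 0" using D(5)[OF i] u by auto
    then obtain v where v: "arc v" "path_image v = w i ` {0..u}" "pathstart v = w i 0" "pathfinish v = w i u"
      using arc_reparametrize[OF D(4)[OF i], of 0 u] u by auto
    have sub: "path_image v \<subseteq> path_image (w i)" using v(2) u by (auto simp: path_image_def)
    have "w i 0 \<in> path_image v" using v(3) pathstart_in_path_image by metis
    then show ?thesis using v sub D(5)[OF i] D(6)[OF i] by (intro exI[of _ v]) blast
  qed
  show thesis
  proof (cases "pathfinish g \<in> T")
    case True
    show thesis
    proof (cases "pathfinish g \<in> B")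
      case True
      then show thesis using that[OF W] e by force
    next
      case False
      then obtain i u where i: "i < n" "u \<in> {0..1}" "w i u = pathfinish g"
        using True unfolding T_def whisker_union_def path_image_def by auto
      obtain v where v: "arc v" "pathstart v = w i 0" "pathfinish v = w i u"
        "path_image v \<subseteq> path_image (w i)" "path_image v \<inter> B = {w i 0}"
        "\<forall>j<n. j \<noteq> i \<longrightarrow> path_image v \<inter> path_image (w j) \<subseteq> B"
        using initial[OF i(1,2)] False i(3) by metis
      show thesis
        by (rule replace_absorb[OF i(1) v(1)])
          (use v i in \<open>auto simp: T_def whisker_union_def\<close>)
    qed
  next
    case False
    have contg: "continuous_on {0..1} g"
      using g(1) by (auto simp: arc_def path_def)
    \<comment> \<open>By compactness there is a last parameter, \<open>s\<close>, at which \<open>g\<close> visits \<open>T\<close>.\<close>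
    have "compact T" unfolding T_def whisker_union_def
      using D(2,4) by (intro compact_Un compact_UN) (auto intro: compact_path_image arc_imp_path)
    then have "closed ({0..1} \<inter> g -` T)"
      by (intro continuous_closed_preimage contg closed_atLeastAtMost compact_imp_closed)
    moreover have "bounded ({0..1} \<inter> g -` T)"
      by (rule bounded_subset[OF bounded_closed_interval[of 0 1]]) auto
    ultimately have "compact ({0..1} \<inter> g -` T)" by (simp add: compact_eq_bounded_closed)
    moreover have "0 \<in> {0..1} \<inter> g -` T"
      using g(2) by (auto simp: T_def whisker_union_def pathstart_def)
    ultimately obtain s where s: "s \<in> {0..1}" "g s \<in> T"
      "\<And>t. \<lbrakk>t \<in> {0..1}; g t \<in> T\<rbrakk> \<Longrightarrow> t \<le> s"
      using compact_attains_sup[of "{0..1} \<inter> g -` T"] by (metis IntE IntI empty_iff vimageE vimageI)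
    have "s \<noteq> 1" using False s(2) by (auto simp: pathfinish_def)
    then have "s < 1" using s(1) by simp
    then obtain h where h: "arc h" "path_image h = g ` {s..1}" "pathstart h = g s" "pathfinish h = pathfinish g"
      using arc_reparametrize[OF g(1), of s 1] s(1) by (auto simp: pathfinish_def)
    have hT: "path_image h \<inter> T = {g s}"
    proof -
      have "\<forall>t\<in>{s..1}. g t \<in> T \<longrightarrow> t = s"
        using s by (metis antisym atLeastAtMost_iff order_trans)
      then have "path_image h \<inter> T \<subseteq> {g s}" unfolding h(2) by blast
      moreover have "g s \<in> path_image h" using \<open>s < 1\<close> h(2) by auto
      ultimately show ?thesis using s(2) by blast
    qed
    have hsub: "path_image h \<subseteq> path_image g" using h(2) s(1) by (auto simp: path_image_def)
    show thesis
    proof (cases "g s \<in> B")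
      case True
      have BT: "B \<subseteq> T" "\<And>i. i < n \<Longrightarrow> path_image (w i) \<subseteq> T" by (auto simp: T_def whisker_union_def)
      have W': "whiskered p n (B \<union> path_image h) w"
        unfolding whiskered_def
      proof (intro conjI allI impI)
        show "p \<in> B \<union> path_image h" using D(1) by simp
        show "compact (B \<union> path_image h)"
          using D(2) h(1) by (intro compact_Un compact_path_image arc_imp_path)
        have "g s \<in> B \<inter> path_image h" using True hT by blast
        then show "connected (B \<union> path_image h)"
          using D(3) h(1) by (intro connected_Un connected_path_image arc_imp_path) auto
        show "arc (w i)" if "i < n" for i using D(4)[OF that] .
        show "path_image (w i) \<inter> (B \<union> path_image h) = {pathstart (w i)}" if "i < n" for i
        proof -
          have "path_image h \<inter> path_image (w i) \<subseteq> path_image h \<inter> T" using BT(2)[OF that] by blast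
          also have "\<dots> \<subseteq> B" unfolding hT using True by simp
          finally have "path_image (w i) \<inter> (B \<union> path_image h) = path_image (w i) \<inter> B" by blast
          then show ?thesis using D(5)[OF that] by (simp add: pathstart_def)
        qed
        show "path_image (w i) \<inter> path_image (w j) \<subseteq> B \<union> path_image h"
          if "i < n" "j < n" "i \<noteq> j" for i j using D(6)[OF that] by blast
      qed
      have "pathfinish g \<in> path_image h" using h(4) pathfinish_in_path_image by metis
      then have "\<exists>b\<in>B \<union> path_image h. dist (pathfinish g) b < e" using e by force
      moreover have "whisker_union n (B \<union> path_image h) w \<subseteq> whisker_union n B w \<union> path_image g"
        using hsub by (auto simp: whisker_union_def)
      ultimately show thesis using that[OF W'] by blast
    next
      case sB: False
      then obtain i u where i: "i < n" "u \<in> {0..1}" "w i u = g s"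
        using s(2) unfolding T_def whisker_union_def path_image_def by auto
      obtain v where v: "arc v" "pathstart v = w i 0" "pathfinish v = w i u"
        "path_image v \<subseteq> path_image (w i)" "path_image v \<inter> B = {w i 0}"
        "\<forall>j<n. j \<noteq> i \<longrightarrow> path_image v \<inter> path_image (w j) \<subseteq> B"
        using initial[OF i(1,2)] sB i(3) by metis
      have iT: "path_image (w j) \<subseteq> T" if "j < n" for j using that by (auto simp: T_def whisker_union_def)
      have BT: "B \<subseteq> T" by (auto simp: T_def whisker_union_def)
      have vh: "path_image v \<inter> path_image h \<subseteq> {g s}" using hT v(4) iT[OF i(1)] by blast
      have gsv: "g s \<in> path_image v" using v(3) i(3) pathfinish_in_path_image by metis
      have join: "pathfinish v = pathstart h" using v(3) h(3) i(3) by simp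
      have im: "path_image (v +++ h) = path_image v \<union> path_image h"
        by (rule path_image_join[OF join])
      show thesis
      proof (rule replace_absorb[OF i(1)])
        show "arc (v +++ h)" by (rule arc_join[OF v(1) h(1) join]) (use vh h(3) in auto)
        have "path_image h \<inter> B = {}" using equalityD1[OF hT] BT sB by auto
        then show "path_image (v +++ h) \<inter> B = {pathstart (v +++ h)}"
          unfolding im using v(2,5) by auto
        show "path_image (v +++ h) \<inter> path_image (w j) \<subseteq> B" if "j < n" "j \<noteq> i" for j
        proof -
          have "path_image h \<inter> path_image (w j) \<subseteq> path_image v \<inter> path_image (w j)"
            using equalityD1[OF hT] iT[OF that(1)] gsv by auto
          then show ?thesis unfolding im using v(6) that by blast
        qed
        show "path_image (v +++ h) \<subseteq> T \<union> path_image g"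
          unfolding im using v(4) iT[OF i(1)] hsub by blast
        show "pathfinish (v +++ h) = pathfinish g" using h(4) by simp
      qed
    qed
  qed
qed

text \<open>Initial pieces of the \<open>n\<close> arms are short by continuity.\<close>

lemma whiskered_at_vertex:
  assumes N: "simple_od n p N" and r: "r > 0"
  obtains w where "whiskered p n {p} w" "whisker_union n {p} w \<subseteq> N \<inter> ball p r"
proof -
  obtain g where g: "\<And>i. i < n \<Longrightarrow> arc (g i)" "\<And>i. i < n \<Longrightarrow> pathstart (g i) = p"
    "N = (\<Union>i<n. path_image (g i))" "n \<ge> 1"
    "\<And>i j. \<lbrakk>i < n; j < n; i \<noteq> j\<rbrakk> \<Longrightarrow> path_image (g i) \<inter> path_image (g j) = {p}"
    using N unfolding simple_od_def by blast
  have "\<exists>h. arc h \<and> pathstart h = p \<and> path_image h \<subseteq> path_image (g i) \<inter> ball p r" if i: "i < n" for i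
  proof -
    have "continuous_on {0..1} (g i)" using g(1)[OF i] by (simp add: arc_def path_def)
    then obtain d where d: "d > 0" "\<And>t. \<lbrakk>t \<in> {0..1}; dist t 0 < d\<rbrakk> \<Longrightarrow> dist (g i t) (g i 0) < r"
      using r unfolding continuous_on_iff by (metis atLeastAtMost_iff order_refl zero_le_one)
    define u where "u = min 1 (d/2)"
    have u: "0 < u" "u \<le> 1" "u < d" using d(1) by (auto simp: u_def)
    obtain h where h: "arc h" "path_image h = g i ` {0..u}" "pathstart h = g i 0"
      using arc_reparametrize[OF g(1)[OF i], of 0 u] u by (metis order_refl)
    have p: "g i 0 = p" using g(2)[OF i] by (simp add: pathstart_def)
    have "path_image h \<subseteq> path_image (g i) \<inter> ball p r"
      using d(2) u p unfolding h(2) unfolding path_image_def by (auto simp: dist_commute)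
    then show ?thesis using h(1,3) unfolding p by blast
  qed
  then obtain w where w: "\<And>i. i < n \<Longrightarrow> arc (w i)" "\<And>i. i < n \<Longrightarrow> pathstart (w i) = p"
    "\<And>i. i < n \<Longrightarrow> path_image (w i) \<subseteq> path_image (g i) \<inter> ball p r" by metis
  have pin: "p \<in> path_image (w i)" if "i < n" for i using w(2)[OF that] pathstart_in_path_image by metis
  have "whiskered p n {p} w"
    unfolding whiskered_def
  proof (intro conjI allI impI)
    show "path_image (w i) \<inter> path_image (w j) \<subseteq> {p}" if "i < n" "j < n" "i \<noteq> j" for i j
      unfolding g(5)[OF that, symmetric] using w(3) that by blast
  qed (use w(1,2) pin in auto)
  moreover have wN: "path_image (w i) \<subseteq> N \<inter> ball p r" if "i < n" for i
  proof -
    have "path_image (g i) \<subseteq> N" unfolding g(3) by (rule UN_upper) (use that in simp)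
    then show ?thesis using w(3)[OF that] by blast
  qed
  moreover have "p \<in> N \<inter> ball p r" using pin[of 0] wN[of 0] g(4) by auto
  then have "whisker_union n {p} w \<subseteq> N \<inter> ball p r"
    unfolding whisker_union_def by (intro Un_least UN_least wN) auto
  ultimately show ?thesis using that by blast
qed

lemma whiskered_near_finite:
  assumes X: "arc_length_metric X" and A: "connected A" "A \<subseteq> X" "p \<in> A" and r: "r > 0"
    and N: "simple_od n p N" "N \<subseteq> X" and F: "finite F" "F \<subseteq> A"
  shows "\<exists>B w. whiskered p n B w \<and> whisker_union n B w \<subseteq> X \<inter> nbhd dist r A \<and>
    (\<forall>f\<in>F. \<exists>b\<in>B. dist f b < r)"
  using F
proof (induction F rule: finite_induct)
  case empty
  obtain w where w: "whiskered p n {p} w" "whisker_union n {p} w \<subseteq> N \<inter> ball p r"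
    using whiskered_at_vertex[OF N(1) r] by blast
  have "ball p r \<subseteq> nbhd dist r A" using A(3) by (auto simp: nbhd_def dist_commute)
  then show ?case using w N(2) by blast
next
  case (insert f F)
  then obtain B w where W: "whiskered p n B w" "whisker_union n B w \<subseteq> X \<inter> nbhd dist r A"
    "\<forall>f\<in>F. \<exists>b\<in>B. dist f b < r" by auto
  show ?case
  proof (cases "f = p")
    case True
    then show ?thesis using W whiskeredD(1)[OF W(1)] r by (intro exI[of _ B] exI[of _ w]) force
  next
    case False
    have "path_component (X \<inter> nbhd dist r A) p f"
      using path_component_nbhd[OF X A(1,2) r A(3), of f] insert.prems by simp
    then obtain g where g: "path g" "path_image g \<subseteq> X \<inter> nbhd dist r A"
      "pathstart g = p" "pathfinish g = f"
      unfolding path_component_def by metis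
    obtain h where h: "arc h" "path_image h \<subseteq> path_image g" "pathstart h = p" "pathfinish h = f"
      using arc_in_path_image[OF g(1)] g(3,4) False by metis
    have "pathstart h \<in> B" using h(3) whiskeredD(1)[OF W(1)] by simp
    then obtain B' w' where B': "whiskered p n B' w'" "B \<subseteq> B'"
      "whisker_union n B' w' \<subseteq> whisker_union n B w \<union> path_image h"
      "\<exists>b\<in>B'. dist (pathfinish h) b < r"
      using whiskered_reach[OF W(1) h(1) _ r] by blast
    have "whisker_union n B' w' \<subseteq> X \<inter> nbhd dist r A" using B'(3) W(2) h(2) g(2) by blast
    moreover have "\<forall>f\<in>insert f F. \<exists>b\<in>B'. dist f b < r" using B'(2,4) W(3) h(4) by blast
    ultimately show ?thesis using B'(1) by blast
  qed
qed

section \<open>Cells near a given continuum\<close>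

theorem theorem3p3:
  fixes X :: "'a::metric_space set" and p :: 'a and n :: nat
    and A :: "'a set" and \<epsilon> :: real
  assumes "finite_graph X" and "arc_length_metric X"
    and "p \<in> X" and "has_order p X n"
    and "A \<in> hyper_conn_at p X" and "\<epsilon> > 0"
  shows "\<exists>\<A>. \<A> \<subseteq> hyper_conn_at p X \<and> closedin (hyper_topology X) \<A> \<and>
    (\<exists>\<K>\<subseteq>\<A>. n_cell n (subtopology (hyper_topology X) \<K>)) \<and>
    hyper_dist2 \<A> {A} < \<epsilon>"
proof -
  \<comment> \<open>One \<open>r\<close> for the net, one for the distance from the net to \<open>B\<close>, and two more turn weak
    inequalities into the strict one claimed: \<open>near\<close> gives \<open>2 r\<close>, and \<open>3 r\<close> is less than \<open>\<epsilon>\<close>.\<close>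
  define r where "r = \<epsilon> / 4"
  have r: "r > 0" using \<open>\<epsilon> > 0\<close> by (simp add: r_def)
  have X: "compact X" using \<open>finite_graph X\<close> by (simp add: finite_graph_def continuum_def)
  have A: "connected A" "A \<subseteq> X" "p \<in> A" "closedin (top_of_set X) A"
    using \<open>A \<in> hyper_conn_at p X\<close> closedin_imp_subset
    by (auto simp: hyper_conn_at_def hyper_conn_def hyper_closed_def)
  obtain N where N: "simple_od n p N" "N \<subseteq> X"
    using \<open>has_order p X n\<close> closedin_imp_subset unfolding has_order_def by blast
  have "compact A" using A(4) X closedin_compact by blast
  then obtain F where F: "finite F" "F \<subseteq> A" "A \<subseteq> (\<Union>x\<in>F. ball x r)"
  proof (rule compactE_image)
    show "A \<subseteq> (\<Union>x\<in>A. ball x r)" using r by force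
  qed simp
  obtain B w where W: "whiskered p n B w" "whisker_union n B w \<subseteq> X \<inter> nbhd dist r A"
    "\<forall>f\<in>F. \<exists>b\<in>B. dist f b < r"
    using whiskered_near_finite[OF assms(2) A(1-3) r N F(1,2)] by blast
  define I where "I = PiE {..<n} (\<lambda>_. {0..1::real})"
  define \<A> where "\<A> = trimmed n B w ` I"
  have "whisker_union n B w \<subseteq> X" using W(2) by blast
  note cell = whiskered_n_cell[OF W(1) X this I_def, folded \<A>_def]
  have near: "hyper_dist K A \<le> 2 * r" if K: "K \<in> \<A>" for K
  proof (rule hausdorff_dist_le_radius)
    obtain t where t: "t \<in> I" "K = trimmed n B w t" using K by (auto simp: \<A>_def)
    then have "\<forall>i<n. t i \<in> {0..1}" by (auto simp: I_def PiE_iff)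
    note T = trimmed_props[OF W(1) this, folded t(2)]
    show "K \<subseteq> nbhd dist (2 * r) A"
      using T(5) W(2) r unfolding nbhd_def by force
    show "A \<subseteq> nbhd dist (2 * r) K"
    proof
      fix a assume "a \<in> A"
      then obtain f where f: "f \<in> F" "dist f a < r" using F(3) by auto
      then obtain b where b: "b \<in> B" "dist f b < r" using W(3) by blast
      have "dist a b < 2 * r" using dist_triangle[of a b f] f(2) b(2) by (simp add: dist_commute)
      then show "a \<in> nbhd dist (2 * r) K" using T(4) b(1) by (auto simp: nbhd_def)
    qed
  qed (use r in simp)
  have "(\<lambda>i\<in>{..<n}. 0) \<in> I" by (simp add: I_def)
  then have "\<A> \<noteq> {}" by (auto simp: \<A>_def)
  then have "hyper_dist2 \<A> {A} \<le> 3 * r"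
    using near r hausdorff_dist_commute[of dist A]
    by (intro hausdorff_dist_singleton_le) (force intro: le_less_trans)+
  then have "hyper_dist2 \<A> {A} < \<epsilon>" using r by (simp add: r_def)
  then show ?thesis using cell by blast
qed

end
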